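(* Fix the parameters $n,p_{\mathrm{gen}},p_{\mathrm{con}},\Gamma,F_{\mathrm{new}}$ and the policy coefficients $(a_k,b_k,c_k,d_k)_{k=1}^n$ of a 1G$n$B system. If $J_k(F_{\mathrm{new}})\ge F_{\mathrm{new}}$ for all $k\in\{1,\dots,n\}$, then the average consumed fidelity $\overline F$ is a non-decreasing function of the purification probability $q\in[0,1]$, i.e. $$\frac{\partial\overline F}{\partial q}\ge0 .$$
   Context: Model (1G$n$B system). Parameters: an integer $n\ge1$; $p_{\mathrm{gen}}\in(0,1]$; $p_{\mathrm{con}}\in(0,1]$; $q\in[0,1]$; $\Gamma\ge0$; $F_{\mathrm{new}}\in(1/4,1]$; and, for $k=1,\dots,n$, real constants $a_k,b_k,c_k,d_k$ (the purification policy). Put $p_k(F)=c_k(F-\frac14)+d_k$ (success probability) and $J_k(F)=\frac14+\frac{a_k(F-1/4)+b_k}{c_k(F-1/4)+d_k}$ (jump function). Physicality: for all $F\in[1/4,1]$, $0\le p_k(F)\le1$ and $0\le a_k(F-\frac14)+b_k\le\frac34p_k(F)$ (i.e. $J_k(F)\in[1/4,1]$ when $p_k(F)>0$). Dynamics. For $t=1,2,\dots$ let $X_t\sim\mathrm{Bernoulli}(p_{\mathrm{con}})$ (a consumption request arrives at time $t$), $K_t\sim\mathrm{Bin}(n,p_{\mathrm{gen}})$, $Q_t\sim\mathrm{Bernoulli}(q)$, $W_t\sim\mathrm{Unif}[0,1]$, all independent. $F(t)$ is the fidelity of the link in memory G at time $t$ ($F(t)=0$ means G is empty); $F(0)=F_{\mathrm{new}}$.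 Let $F^-(t)=e^{-\Gamma}(F(t-1)-\frac14)+\frac14$ if $F(t-1)>0$ and $F^-(t)=0$ if $F(t-1)=0$. If $F(t-1)=0$, then $F(t)=F_{\mathrm{new}}$ if $K_t\ge1$ and $F(t)=0$ otherwise. If $F(t-1)>0$: when $X_t=1$, $F(t)=0$ (consumption); when $X_t=0$, $K_t\ge1$, $Q_t=1$, with $k=K_t$, $F(t)=J_k(F^-(t))$ if $W_t<p_k(F^-(t))$ and $F(t)=0$ otherwise; in all remaining cases $F(t)=F^-(t)$. The average consumed fidelity is $\overline F=\lim_{m\to\infty}\frac{\sum_{j=1}^mF^-(T^{(j)}_{\mathrm{con}})}{\sum_{j=1}^m\mathbb 1\{F^-(T^{(j)}_{\mathrm{con}})>0\}}$, where $T^{(j)}_{\mathrm{con}}$ is the $j$-th time with $X_t=1$. Convention. $\overline F$ is almost surely equal to a deterministic function of the parameters, and $\overline F$ denotes this function: $\overline F=\frac{\tilde wF_{\mathrm{new}}+\tilde x}{\tilde yF_{\mathrm{new}}+\tilde z}$ with $\tilde w=p_{\mathrm{con}}+q(1-p_{\mathrm{con}})(p^*_{\mathrm{gen}}+\frac14\tilde c-\tilde d)$, $\tilde x=\frac14[e^\Gamma-1+q(1-p_{\mathrm{con}})(-\tilde a+4\tilde b-\frac14\tilde c+\tilde d)]$, $\tilde y=q(1-p_{\mathrm{con}})\tilde c$, $\tilde z=e^\Gamma-1+p_{\mathrm{con}}+q(1-p_{\mathrm{con}})(p^*_{\mathrm{gen}}-\tilde a-\frac14\tilde c)$, $p^*_{\mathrm{gen}}=1-(1-p_{\mathrm{gen}})^n$,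 $\tilde a=\sum_{k=1}^na_k\binom nk(1-p_{\mathrm{gen}})^{n-k}p_{\mathrm{gen}}^k$, and $\tilde b,\tilde c,\tilde d$ defined likewise from $b_k,c_k,d_k$. *)

theory Defs
  imports Complex_Main
begin

text \<open>
  A purification policy is given by coefficient sequences \<open>a b c d :: nat \<Rightarrow> real\<close>, of which
  only the entries with index in \<open>{1..n}\<close> matter.
\<close>

definition success_prob :: "(nat \<Rightarrow> real) \<Rightarrow> (nat \<Rightarrow> real) \<Rightarrow> nat \<Rightarrow> real \<Rightarrow> real" where
  "success_prob c d k F = c k * (F - 1/4) + d k"

text \<open>
  The jump function is meaningful only where the success probability is positive. Where that
  probability is 0, division by zero gives the value \<open>1/4\<close>, so for \<open>F > 1/4\<close> the
  condition \<open>jump a b c d k F \<ge> F\<close> implies that the success probability is nonzero.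
\<close>

definition jump ::
    "(nat \<Rightarrow> real) \<Rightarrow> (nat \<Rightarrow> real) \<Rightarrow> (nat \<Rightarrow> real) \<Rightarrow> (nat \<Rightarrow> real) \<Rightarrow> nat \<Rightarrow> real \<Rightarrow> real" where
  "jump a b c d k F = 1/4 + (a k * (F - 1/4) + b k) / (c k * (F - 1/4) + d k)"

text \<open>
  The bounds on the numerator of the jump function say that \<open>jump a b c d k F \<in> {1/4..1}\<close>
  whenever the success probability is positive.
\<close>

definition physical_policy ::
    "nat \<Rightarrow> (nat \<Rightarrow> real) \<Rightarrow> (nat \<Rightarrow> real) \<Rightarrow> (nat \<Rightarrow> real) \<Rightarrow> (nat \<Rightarrow> real) \<Rightarrow> bool" where
  "physical_policy n a b c d \<longleftrightarrow>
     (\<forall>k\<in>{1..n}. \<forall>F\<in>{1/4..1}.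
        0 \<le> success_prob c d k F \<and> success_prob c d k F \<le> 1 \<and>
        0 \<le> a k * (F - 1/4) + b k \<and>
        a k * (F - 1/4) + b k \<le> 3/4 * success_prob c d k F)"

definition gen_prob :: "nat \<Rightarrow> real \<Rightarrow> real" where
  "gen_prob n p_gen = 1 - (1 - p_gen) ^ n"

definition binomial_avg :: "nat \<Rightarrow> real \<Rightarrow> (nat \<Rightarrow> real) \<Rightarrow> real" where
  "binomial_avg n p_gen u =
     (\<Sum>k=1..n. u k * real (n choose k) * (1 - p_gen) ^ (n - k) * p_gen ^ k)"

text \<open>
  The average consumed fidelity, as the deterministic function of the parameters with which
  the long-run average of the consumed fidelities agrees almost surely.
\<close>

definition avg_consumed_fidelity ::
    "nat \<Rightarrow> real \<Rightarrow> real \<Rightarrow> real \<Rightarrow> real \<Rightarrow>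
     (nat \<Rightarrow> real) \<Rightarrow> (nat \<Rightarrow> real) \<Rightarrow> (nat \<Rightarrow> real) \<Rightarrow> (nat \<Rightarrow> real) \<Rightarrow> real \<Rightarrow> real" where
  "avg_consumed_fidelity n p_gen p_con \<Gamma> F_new a b c d q =
     (let P  = gen_prob n p_gen;
          a' = binomial_avg n p_gen a;
          b' = binomial_avg n p_gen b;
          c' = binomial_avg n p_gen c;
          d' = binomial_avg n p_gen d;
          w = p_con + q * (1 - p_con) * (P + 1/4 * c' - d');
          x = 1/4 * (exp \<Gamma> - 1 + q * (1 - p_con) * (- a' + 4 * b' - 1/4 * c' + d'));
          y = q * (1 - p_con) * c';
          z = exp \<Gamma> - 1 + p_con + q * (1 - p_con) * (P - a' - 1/4 * c')
      in (w * F_new + x) / (y * F_new + z))"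

end

theory Submission imports Defs begin

text \<open>
  Write \<open>f = F_new - 1/4\<close>, \<open>P = gen_prob n p_gen\<close> and \<open>a', b', c', d'\<close> for the binomial averages
  of the policy coefficients. After subtracting \<open>1/4\<close>, the average consumed fidelity becomes the
  linear fractional function
  \<open>(p_con * f + s * (P * f + b' - d' * f)) / (exp \<Gamma> - 1 + p_con + s * (P - a' + c' * f))\<close> of
  \<open>s = q * (1 - p_con)\<close>. Its determinant is
  \<open>(exp \<Gamma> - 1) * ((P - d') * f + b') + p_con * ((a' * f + b') - f * (c' * f + d'))\<close>.
  The first summand is nonnegative by physicality at fidelity \<open>1/4\<close>, the second one by the
  assumption on the jump functions.
\<close>

lemma binomial_avg_add:
  "binomial_avg n p (\<lambda>k. u k + v k) = binomial_avg n p u + binomial_avg n p v"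
  by (simp add: binomial_avg_def algebra_simps sum.distrib)

lemma binomial_avg_diff:
  "binomial_avg n p (\<lambda>k. u k - v k) = binomial_avg n p u - binomial_avg n p v"
  by (simp add: binomial_avg_def algebra_simps sum_subtractf)

lemma binomial_avg_mult_right:
  "binomial_avg n p (\<lambda>k. u k * r) = binomial_avg n p u * r"
  by (simp add: binomial_avg_def sum_distrib_left mult_ac)

text \<open>By the binomial theorem all weights sum to 1; the average omits the term at
  \<open>k = 0\<close>, which is \<open>(1 - p) ^ n\<close>. This lets \<open>P\<close> be treated
  as an average alongside the coefficients.\<close>

lemma binomial_avg_one: "binomial_avg n p (\<lambda>_. 1) = gen_prob n p"
proof -
  have "1 = (p + (1 - p)) ^ n" by simp
  also have "\<dots> = (\<Sum>k\<le>n. real (n choose k) * p ^ k * (1 - p) ^ (n - k))"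
    by (simp only: binomial_ring of_nat_id)
  also have "\<dots> = (1 - p) ^ n + (\<Sum>k=1..n. real (n choose k) * p ^ k * (1 - p) ^ (n - k))"
    by (simp add: atMost_atLeast0 sum.atLeast_Suc_atMost)
  finally show ?thesis
    by (simp add: binomial_avg_def gen_prob_def mult_ac)
qed

lemma binomial_avg_nonneg:
  assumes "0 \<le> p" "p \<le> 1" "\<And>k. k \<in> {1..n} \<Longrightarrow> 0 \<le> u k"
  shows "0 \<le> binomial_avg n p u"
  unfolding binomial_avg_def using assms by (intro sum_nonneg mult_nonneg_nonneg) auto

lemma linear_fractional_mono_on:
  fixes \<alpha> \<beta> \<delta> \<epsilon> :: real
  assumes "0 < \<delta>" "0 \<le> \<epsilon>" "\<alpha> * \<epsilon> \<le> \<beta> * \<delta>"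
  shows "mono_on {0..} (\<lambda>q. (\<alpha> + q * \<beta>) / (\<delta> + q * \<epsilon>))"
proof (rule mono_onI)
  fix q r :: real
  assume "q \<in> {0..}" "r \<in> {0..}" "q \<le> r"
  then have pos: "0 < \<delta> + q * \<epsilon>" "0 < \<delta> + r * \<epsilon>"
    using assms by (auto intro: add_pos_nonneg)
  have "0 \<le> (r - q) * (\<beta> * \<delta> - \<alpha> * \<epsilon>)"
    using assms \<open>q \<le> r\<close> by simp
  then have "(\<alpha> + q * \<beta>) * (\<delta> + r * \<epsilon>) \<le> (\<alpha> + r * \<beta>) * (\<delta> + q * \<epsilon>)"
    by (simp add: algebra_simps)
  then show "(\<alpha> + q * \<beta>) / (\<delta> + q * \<epsilon>) \<le> (\<alpha> + r * \<beta>) / (\<delta> + r * \<epsilon>)"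
    using pos by (simp add: divide_simps)
qed

lemma linear_fractional_has_real_derivative:
  fixes \<alpha> \<beta> \<delta> \<epsilon> q :: real
  assumes "\<delta> + q * \<epsilon> \<noteq> 0"
  shows "((\<lambda>q. (\<alpha> + q * \<beta>) / (\<delta> + q * \<epsilon>)) has_real_derivative
    (\<beta> * \<delta> - \<alpha> * \<epsilon>) / (\<delta> + q * \<epsilon>)\<^sup>2) (at q within S)"
  using assms
  by (auto intro!: derivative_eq_intros simp: power2_eq_square algebra_simps)

lemma physical_policy_at:
  assumes "physical_policy n a b c d" "k \<in> {1..n}" "f \<in> {0..3/4}"
  shows "0 \<le> c k * f + d k" "c k * f + d k \<le> 1"
    "0 \<le> a k * f + b k" "a k * f + b k \<le> 3/4 * (c k * f + d k)"
proof -
  have "f + 1/4 \<in> {1/4..1}" using assms(3) by auto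
  from assms(1)[unfolded physical_policy_def, rule_format, OF assms(2) this]
  show "0 \<le> c k * f + d k" "c k * f + d k \<le> 1"
    "0 \<le> a k * f + b k" "a k * f + b k \<le> 3/4 * (c k * f + d k)"
    by (simp_all add: success_prob_def)
qed

lemma physical_policy_denominator_nonneg:
  assumes "physical_policy n a b c d" "k \<in> {1..n}" "f \<in> {0..3/4}"
  shows "0 \<le> 1 - a k + c k * f"
proof -
  \<comment> \<open>Physicality at the fidelities 1 and 1/4 bounds \<open>a k\<close> by \<open>3/4 * c k + d k\<close>; what remains is
    the bound by 1 on the success probability at the reflected point \<open>3/4 - f\<close>.\<close>
  have "a k * (3/4) + b k \<le> 3/4 * (c k * (3/4) + d k)"
    using physical_policy_at(4)[OF assms(1,2), of "3/4"] by simp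
  moreover have "0 \<le> b k"
    using physical_policy_at(3)[OF assms(1,2), of 0] by simp
  moreover have "c k * (3/4 - f) + d k \<le> 1"
    using physical_policy_at(2)[OF assms(1,2), of "3/4 - f"] assms(3) by simp
  ultimately show ?thesis by (simp add: algebra_simps)
qed

lemma le_jump_imp:
  assumes "physical_policy n a b c d" "k \<in> {1..n}" "1/4 < F" "F \<le> 1" "F \<le> jump a b c d k F"
  shows "(F - 1/4) * (c k * (F - 1/4) + d k) \<le> a k * (F - 1/4) + b k"
proof -
  have "0 \<le> c k * (F - 1/4) + d k"
    using physical_policy_at(1)[OF assms(1,2), of "F - 1/4"] assms(3,4) by simp
  \<comment> \<open>If the success probability vanished, division by zero would give
    \<open>jump a b c d k F = 1/4 < F\<close>.\<close>
  moreover have "c k * (F - 1/4) + d k \<noteq> 0"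
    using assms(3,5) by (auto simp: jump_def)
  ultimately have "0 < c k * (F - 1/4) + d k" by simp
  moreover have "F - 1/4 \<le> (a k * (F - 1/4) + b k) / (c k * (F - 1/4) + d k)"
    using assms(5) unfolding jump_def by linarith
  ultimately show ?thesis
    by (simp only: pos_le_divide_eq)
qed

text \<open>Subtracting 1/4 cancels the averages of \<open>a\<close> and \<open>c\<close> from the
  numerator, and the constant \<open>exp \<Gamma> - 1\<close> with them.\<close>

lemma avg_consumed_fidelity_eq:
  fixes F_new :: real
  defines "f \<equiv> F_new - 1/4"
  assumes "exp \<Gamma> - 1 + p_con + q * ((1 - p_con) *
    (gen_prob n p_gen - binomial_avg n p_gen a + binomial_avg n p_gen c * f)) \<noteq> 0"
  shows "avg_consumed_fidelity n p_gen p_con \<Gamma> F_new a b c d q = 1/4 +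
    (p_con * f + q * ((1 - p_con) *
      (gen_prob n p_gen * f + binomial_avg n p_gen b - binomial_avg n p_gen d * f))) /
    (exp \<Gamma> - 1 + p_con + q * ((1 - p_con) *
      (gen_prob n p_gen - binomial_avg n p_gen a + binomial_avg n p_gen c * f)))"
    (is "_ = 1/4 + ?num / ?den")
proof -
  have "avg_consumed_fidelity n p_gen p_con \<Gamma> F_new a b c d q = (?num + 1/4 * ?den) / ?den"
    unfolding avg_consumed_fidelity_def Let_def f_def
    by (intro arg_cong2[where f = "(/)"]) (simp_all add: algebra_simps diff_divide_distrib)
  also have "\<dots> = 1/4 + ?num / ?den"
    by (rule add_num_frac[OF assms(2), symmetric])
  finally show ?thesis .
qed

theorem proposition2:
  fixes n :: nat
    and p_gen p_con \<Gamma> F_new :: real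
    and a b c d :: "nat \<Rightarrow> real"
  assumes "n \<ge> 1"
    and "0 < p_gen" "p_gen \<le> 1"
    and "0 < p_con" "p_con \<le> 1"
    and "\<Gamma> \<ge> 0"
    and "1/4 < F_new" "F_new \<le> 1"
    and "physical_policy n a b c d"
    and "\<And>k. k \<in> {1..n} \<Longrightarrow> jump a b c d k F_new \<ge> F_new"
  shows "mono_on {0..1} (avg_consumed_fidelity n p_gen p_con \<Gamma> F_new a b c d) \<and>
    (\<forall>q\<in>{0..1}. \<exists>D\<ge>0.
       (avg_consumed_fidelity n p_gen p_con \<Gamma> F_new a b c d has_real_derivative D)
         (at q within {0..1}))"
proof -
  define f where "f = F_new - 1/4"
  define P where "P = gen_prob n p_gen"
  define a' where "a' = binomial_avg n p_gen a"
  define b' where "b' = binomial_avg n p_gen b"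
  define c' where "c' = binomial_avg n p_gen c"
  define d' where "d' = binomial_avg n p_gen d"
  note avg = P_def a'_def b'_def c'_def d'_def
  note linear = binomial_avg_add binomial_avg_diff binomial_avg_mult_right binomial_avg_one
  define g where "g = exp \<Gamma> - 1"
  define \<alpha> where "\<alpha> = p_con * f"
  define \<beta> where "\<beta> = (1 - p_con) * (P * f + b' - d' * f)"
  define \<delta> where "\<delta> = g + p_con"
  define \<epsilon> where "\<epsilon> = (1 - p_con) * (P - a' + c' * f)"
  let ?\<Phi> = "avg_consumed_fidelity n p_gen p_con \<Gamma> F_new a b c d"
  have f: "0 < f" "f \<in> {0..3/4}" using assms(7,8) by (auto simp: f_def)
  have g: "0 \<le> g" using assms(6) by (simp add: g_def)
  have avg_nonneg: "0 \<le> binomial_avg n p_gen u" if "\<And>k. k \<in> {1..n} \<Longrightarrow> 0 \<le> u k" for u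
    using assms(2,3) that by (intro binomial_avg_nonneg) auto
  \<comment> \<open>\<open>P\<close> averages the constant 1, and \<open>d k\<close> is the success
    probability at fidelity 1/4.\<close>
  have P_ge_d: "0 \<le> P - d'"
    using avg_nonneg[of "\<lambda>k. 1 - d k"] physical_policy_at(2)[OF assms(9), of _ 0]
    by (simp add: avg linear)
  have b_nonneg: "0 \<le> b'"
    using avg_nonneg[of b] physical_policy_at(3)[OF assms(9), of _ 0] by (simp add: avg)
  have den: "0 \<le> P - a' + c' * f"
    using avg_nonneg[of "\<lambda>k. 1 - a k + c k * f"]
      physical_policy_denominator_nonneg[OF assms(9) _ f(2)]
    by (simp add: avg linear)
  \<comment> \<open>Clearing the denominator of the jump function makes the assumption linear in the
    coefficients, so that it survives averaging over \<open>k\<close>.\<close>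
  have "0 \<le> binomial_avg n p_gen (\<lambda>k. (a k * f + b k) - (c k * f + d k) * f)"
    using le_jump_imp[OF assms(9) _ assms(7,8,10)]
    by (intro avg_nonneg) (simp add: f_def mult.commute)
  then have jump: "0 \<le> (a' * f + b') - (c' * f + d') * f"
    by (simp add: avg linear)
  \<comment> \<open>Strictness comes from \<open>p_con > 0\<close>, which covers
    \<open>\<Gamma> = 0\<close> as well.\<close>
  have \<delta>: "0 < \<delta>" using g assms(4) by (simp add: \<delta>_def)
  have \<epsilon>: "0 \<le> \<epsilon>" using den assms(5) by (simp add: \<epsilon>_def)
  \<comment> \<open>The factor \<open>1 - p_con\<close> appears because the variable is now
    \<open>q\<close> and no longer \<open>q * (1 - p_con)\<close>.\<close>
  have "\<beta> * \<delta> - \<alpha> * \<epsilon> =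
      (1 - p_con) * (g * ((P - d') * f + b') + p_con * ((a' * f + b') - (c' * f + d') * f))"
    unfolding \<alpha>_def \<beta>_def \<delta>_def \<epsilon>_def by algebra
  also have "\<dots> \<ge> 0"
    using assms(4,5) g P_ge_d f(1) b_nonneg jump
    by (intro mult_nonneg_nonneg add_nonneg_nonneg) auto
  finally have det: "\<alpha> * \<epsilon> \<le> \<beta> * \<delta>" by simp
  have pos: "0 < \<delta> + q * \<epsilon>" if "0 \<le> q" for q
    using \<delta> \<epsilon> that by (simp add: add_pos_nonneg)
  have eq: "?\<Phi> q = 1/4 + (\<alpha> + q * \<beta>) / (\<delta> + q * \<epsilon>)" if "0 \<le> q" for q
    using avg_consumed_fidelity_eq[of \<Gamma> p_con q n p_gen a c F_new b d] pos[OF that]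
    by (simp add: \<alpha>_def \<beta>_def \<delta>_def \<epsilon>_def avg f_def g_def)
  have "mono_on {0..1} ?\<Phi>"
  proof (rule mono_onI)
    fix q r :: real
    assume "q \<in> {0..1}" "r \<in> {0..1}" "q \<le> r"
    then show "?\<Phi> q \<le> ?\<Phi> r"
      using mono_onD[OF linear_fractional_mono_on[OF \<delta> \<epsilon> det], of q r] by (simp add: eq)
  qed
  moreover have "\<exists>D\<ge>0. (?\<Phi> has_real_derivative D) (at q within {0..1})" if q: "q \<in> {0..1}" for q
  proof (intro exI conjI)
    show "0 \<le> (\<beta> * \<delta> - \<alpha> * \<epsilon>) / (\<delta> + q * \<epsilon>)\<^sup>2" using det by simp
    have "((\<lambda>q. 1/4 + (\<alpha> + q * \<beta>) / (\<delta> + q * \<epsilon>)) has_real_derivative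
        0 + (\<beta> * \<delta> - \<alpha> * \<epsilon>) / (\<delta> + q * \<epsilon>)\<^sup>2) (at q within {0..1})"
      using pos[of q] q
      by (intro DERIV_add DERIV_const linear_fractional_has_real_derivative) auto
    \<comment> \<open>The closed form \<open>eq\<close> holds on all of \<open>{0..1}\<close>, so
      the radius 1 in the transfer is an arbitrary choice.\<close>
    then show "(?\<Phi> has_real_derivative (\<beta> * \<delta> - \<alpha> * \<epsilon>) / (\<delta> + q * \<epsilon>)\<^sup>2) (at q within {0..1})"
      unfolding add_0 by (rule has_field_derivative_transform_within[OF _ zero_less_one q]) (simp add: eq)
  qed
  ultimately show ?thesis by blast
qed

end
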